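(* Let $n\ge 1$ and let $c_1,\ldots,c_n$ be positive integers. Let $x=[0,\overline{c_1,\ldots,c_n}]$ be the quadratic irrational with periodic simple continued fraction expansion with initial digit $0$ and repeating block $c_1,\ldots,c_n$, and let $x_q$ be its rational part. Then the following are equivalent: (a) $2x_q\in\mathbb{Z}$; (b) $2x_q=-c_n$; (c) the sequence $c_1,\ldots,c_{n-1}$ is symmetric, i.e. $c_k=c_{n-k}$ for $k=1,\ldots,n-1$ (this condition is vacuous when $n=1$).
   Context: A simple continued fraction $[c_0,c_1,c_2,\ldots]$ has $c_0\in\mathbb{Z}$ and $c_k$ positive integers for $k\ge1$; $[0,\overline{c_1,\ldots,c_n}]$ denotes $[0,c_1,\ldots,c_n,c_1,\ldots,c_n,\ldots]$. Every quadratic irrational $x$ can be written uniquely as $x=a+\sqrt b$ with $a,b$ rational, $b>0$ not a square, where $\sqrt b$ denotes a (positive or negative) real square root of $b$; $a$ is called the rational part of $x$, written $x_q$. *)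

theory Defs
  imports Complex_Main
begin

text \<open>\<open>cf_convergent c m\<close> is the value of the finite continued fraction \<open>[c 0, c 1, \<dots>, c m]\<close>.\<close>

fun cf_convergent :: "(nat \<Rightarrow> int) \<Rightarrow> nat \<Rightarrow> real" where
  "cf_convergent c 0 = of_int (c 0)"
| "cf_convergent c (Suc m) = of_int (c 0) + 1 / cf_convergent (\<lambda>k. c (Suc k)) m"

definition cf_value :: "(nat \<Rightarrow> int) \<Rightarrow> real" where
  "cf_value c = lim (cf_convergent c)"

text \<open>The digits of \<open>[0, c 1, \<dots>, c n, c 1, \<dots>, c n, \<dots>]\<close>; only the values
  \<open>c 1, \<dots>, c n\<close> are used.\<close>

definition periodic_digits :: "nat \<Rightarrow> (nat \<Rightarrow> int) \<Rightarrow> nat \<Rightarrow> int" where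
  "periodic_digits n c k = (if k = 0 then 0 else c ((k - 1) mod n + 1))"

text \<open>The library's \<open>sqrt\<close> is the nonnegative root, so the two signs of the root are
  listed explicitly.\<close>

definition quad_decomp :: "real \<Rightarrow> real \<Rightarrow> real \<Rightarrow> bool" where
  "quad_decomp x a b \<longleftrightarrow> a \<in> \<rat> \<and> b \<in> \<rat> \<and> b > 0 \<and> \<not> (\<exists>r\<in>\<rat>. b = r\<^sup>2) \<and>
     (x = a + sqrt b \<or> x = a - sqrt b)"

definition rational_part :: "real \<Rightarrow> real" where
  "rational_part x = (THE a. \<exists>b. quad_decomp x a b)"

lemma quad_decomp_unique:
  assumes "quad_decomp x a b" "quad_decomp x a' b'"
  shows "a = a'" "b = b'"
proof -
  have sq: "(x - a)\<^sup>2 = b"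
    using assms(1) by (auto simp: quad_decomp_def)
  have sq': "(x - a')\<^sup>2 = b'"
    using assms(2) by (auto simp: quad_decomp_def)
  have rats: "a \<in> \<rat>" "b \<in> \<rat>" "a' \<in> \<rat>" "b' \<in> \<rat>"
    and ns: "\<And>r. r \<in> \<rat> \<Longrightarrow> b \<noteq> r\<^sup>2"
    using assms by (auto simp: quad_decomp_def)
  show "a = a'"
  proof (rule ccontr)
    assume ne: "a \<noteq> a'"
    have "b' - b = (a - a') * (2 * (x - a) + (a - a'))"
      unfolding sq[symmetric] sq'[symmetric] by (simp add: power2_eq_square algebra_simps)
    hence "x - a = ((b' - b) / (a - a') - (a - a')) / 2"
      using ne by (simp add: field_simps)
    also have "\<dots> \<in> \<rat>"
      using rats by (intro Rats_divide Rats_diff) auto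
    finally show False
      using ns sq by metis
  qed
  thus "b = b'" using sq sq' by simp
qed

lemma rational_part_eq: "quad_decomp x a b \<Longrightarrow> rational_part x = a"
  unfolding rational_part_def by (blast intro: the_equality quad_decomp_unique(1))

end

theory Submission
  imports Defs
begin

text \<open>
  Let \<open>((p, p'), (q, q'))\<close> be the product of the matrices \<open>((c\<^sub>i, 1), (1, 0))\<close> for \<open>i = 1, \<dots>, n - 1\<close>.
  Periodicity makes \<open>x\<close> a root of \<open>p X\<^sup>2 + (c\<^sub>n p + p' - q) X - (c\<^sub>n q + q')\<close>, whose discriminant
  is \<open>t\<^sup>2 \<plusminus> 4\<close> with \<open>t\<close> the trace of the full period matrix, hence not a square. So twice the rational
  part of \<open>x\<close> is \<open>- c\<^sub>n + (q - p') / p\<close>. As \<open>\<bar>q - p'\<bar> < p\<close>, this is an integer only if \<open>q = p'\<close>,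
  that is, if the matrix is symmetric. Transposing the matrix reverses the digits, and the matrix
  determines the digits once their number is fixed.
\<close>

section \<open>Convergence of simple continued fractions\<close>

lemma cf_convergent_bounds:
  assumes "\<And>k. d k > 0"
  shows "of_int (d 0) \<le> cf_convergent d m" "cf_convergent d m \<le> of_int (d 0) + 1"
proof -
  have "of_int (d 0) \<le> cf_convergent d m \<and> cf_convergent d m \<le> of_int (d 0) + 1"
    using assms
  proof (induction m arbitrary: d)
    case (Suc m)
    let ?K = "cf_convergent (\<lambda>k. d (Suc k)) m"
    have "of_int (d (Suc 0)) \<le> ?K" using Suc.IH[of "\<lambda>k. d (Suc k)", OF Suc.prems] by simp
    moreover have "1 \<le> d (Suc 0)" using Suc.prems[of "Suc 0"] by simp
    ultimately have "1 \<le> ?K" by linarith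
    then show ?case by simp
  qed simp
  then show "of_int (d 0) \<le> cf_convergent d m" "cf_convergent d m \<le> of_int (d 0) + 1" by auto
qed

lemma cf_convergent_ge_1:
  assumes "\<And>k. d k > 0"
  shows "1 \<le> cf_convergent d m"
proof -
  have "1 \<le> d 0" using assms[of 0] by simp
  then show ?thesis using cf_convergent_bounds(1)[of d m, OF assms] by linarith
qed

text \<open>A single step \<open>b + 1 / u\<close> has no uniform contraction factor below 1 near
  \<open>u = 1\<close>. Two steps together do: the difference becomes \<open>u - v\<close> over a
  product of two factors that are each at least 2.\<close>

lemma abs_diff_two_cf_steps_le:
  fixes a b u v :: real
  assumes "a \<ge> 1" "b \<ge> 1" "u \<ge> 1" "v \<ge> 1"
  shows "\<bar>(a + 1 / (b + 1 / u)) - (a + 1 / (b + 1 / v))\<bar> \<le> \<bar>u - v\<bar> / 4"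
proof -
  have "1 * 1 \<le> b * u" "1 * 1 \<le> b * v"
    using assms by (intro mult_mono; simp)+
  then have u: "b * u + 1 \<ge> 2" and v: "b * v + 1 \<ge> 2" by auto
  have eq: "(a + 1 / (b + 1 / u)) - (a + 1 / (b + 1 / v)) = (u - v) / ((b * u + 1) * (b * v + 1))"
    using assms u v by (simp add: divide_simps) (simp add: algebra_simps)
  have "2 * 2 \<le> (b * u + 1) * (b * v + 1)" using u v by (intro mult_mono) auto
  then show ?thesis unfolding eq abs_divide by (intro divide_left_mono) auto
qed

text \<open>The first \<open>2 * j\<close> digits are shared, and each pair of them gains a factor
  1/4. What then remains are two values in the same interval of length 1.\<close>

lemma cf_convergent_diff_le:
  assumes "\<And>k. d k > 0" "m \<ge> 2 * j" "m' \<ge> 2 * j"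
  shows "\<bar>cf_convergent d m - cf_convergent d m'\<bar> \<le> (1 / 4) ^ j"
  using assms
proof (induction j arbitrary: d m m')
  case 0
  show ?case
    using cf_convergent_bounds[of d m, OF 0(1)] cf_convergent_bounds[of d m', OF 0(1)] by simp
next
  case (Suc j)
  obtain k where m: "m = Suc (Suc k)" "k \<ge> 2 * j"
    using Suc.prems(2) that[of "m - 2"] by simp
  obtain k' where m': "m' = Suc (Suc k')" "k' \<ge> 2 * j"
    using Suc.prems(3) that[of "m' - 2"] by simp
  let ?s = "\<lambda>k. d (Suc (Suc k))"
  have "1 \<le> d 0" "1 \<le> d (Suc 0)" using Suc.prems(1)[of 0] Suc.prems(1)[of "Suc 0"] by auto
  then have "\<bar>cf_convergent d m - cf_convergent d m'\<bar>
      \<le> \<bar>cf_convergent ?s k - cf_convergent ?s k'\<bar> / 4"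
    unfolding m m' cf_convergent.simps
    by (intro abs_diff_two_cf_steps_le cf_convergent_ge_1 Suc.prems(1)) auto
  also have "\<dots> \<le> (1 / 4) ^ j / 4"
    by (intro divide_right_mono Suc.IH m m' Suc.prems(1)) auto
  finally show ?case by simp
qed

lemma cf_convergent_LIMSEQ:
  assumes "\<And>k. d k > 0"
  shows "cf_convergent d \<longlonglongrightarrow> cf_value d"
proof -
  have "Cauchy (cf_convergent d)"
  proof (rule metric_CauchyI)
    fix e :: real assume "e > 0"
    then obtain j where j: "(1 / 4 :: real) ^ j < e"
      using real_arch_pow_inv[of e "1 / 4"] by auto
    \<comment> \<open>The witness is \<open>M = 2 * j\<close>.\<close>
    show "\<exists>M. \<forall>m\<ge>M. \<forall>n\<ge>M. dist (cf_convergent d m) (cf_convergent d n) < e"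
      unfolding dist_real_def
      using cf_convergent_diff_le[of d, OF assms] j by (meson le_less_trans)
  qed
  then show ?thesis
    unfolding cf_value_def by (simp add: Cauchy_convergent_iff convergent_LIMSEQ_iff)
qed

lemma cf_value_ge_1:
  assumes "\<And>k. d k > 0"
  shows "1 \<le> cf_value d"
  by (rule LIMSEQ_le_const[OF cf_convergent_LIMSEQ]) (use assms cf_convergent_ge_1 in auto)

text \<open>Positivity is asked from digit 1 on, so that the leading 0 of
  \<open>periodic_digits\<close> is covered. Convergence is inherited from the tail, whose limit is
  nonzero.\<close>

lemma cf_value_Suc:
  assumes "\<And>k. d (Suc k) > 0"
  shows "cf_value d = of_int (d 0) + 1 / cf_value (\<lambda>k. d (Suc k))"
proof -
  let ?s = "\<lambda>k. d (Suc k)"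
  have "cf_value ?s \<noteq> 0" using cf_value_ge_1[of ?s] assms by auto
  then have "(\<lambda>m. of_int (d 0) + 1 / cf_convergent ?s m) \<longlonglongrightarrow> of_int (d 0) + 1 / cf_value ?s"
    by (intro tendsto_intros cf_convergent_LIMSEQ assms)
  then have "(\<lambda>m. cf_convergent d (Suc m)) \<longlonglongrightarrow> of_int (d 0) + 1 / cf_value ?s" by simp
  then have "cf_convergent d \<longlonglongrightarrow> of_int (d 0) + 1 / cf_value ?s" by (rule LIMSEQ_imp_Suc)
  then show ?thesis unfolding cf_value_def by (rule limI)
qed

section \<open>The matrix of a block of digits\<close>

text \<open>\<open>(p, p', q, q')\<close> stands for the matrix with rows \<open>(p, p')\<close> and \<open>(q, q')\<close>.\<close>

fun cf_matrix :: "int list \<Rightarrow> int \<times> int \<times> int \<times> int" where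
  "cf_matrix [] = (1, 0, 0, 1)"
| "cf_matrix (a # as) = (case cf_matrix as of (p, p', q, q') \<Rightarrow> (a * p + q, a * p' + q', p, p'))"

text \<open>Prepending a digit multiplies by its matrix on the left; by associativity, appending one
  multiplies on the right.\<close>

lemma cf_matrix_snoc:
  "cf_matrix (as @ [a]) =
     (case cf_matrix as of (p, p', q, q') \<Rightarrow> (a * p + p', p, a * q + q', q))"
  by (induction as) (auto split: prod.splits simp: algebra_simps)

text \<open>Every factor is a symmetric matrix, so transposing the product just reverses the order
  of the factors.\<close>

lemma cf_matrix_rev:
  "cf_matrix (rev as) = (case cf_matrix as of (p, p', q, q') \<Rightarrow> (p, q, p', q'))"
  by (induction as) (auto simp: cf_matrix_snoc split: prod.splits)

text \<open>Every factor has determinant -1.\<close>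

lemma cf_matrix_det:
  "cf_matrix as = (p, p', q, q') \<Longrightarrow> p * q' - p' * q = (-1) ^ length as"
proof (induction as arbitrary: p p' q q')
  case (Cons a as)
  obtain r r' s s' where M: "cf_matrix as = (r, r', s, s')" by (metis prod_cases4)
  then show ?case using Cons.IH[OF M] Cons.prems by (auto simp: algebra_simps)
qed simp

lemma cf_matrix_bounds:
  assumes "cf_matrix as = (p, p', q, q')" "\<forall>a\<in>set as. a > 0" "as \<noteq> []"
  shows "0 < p'" "p' \<le> p" "0 < q" "q \<le> p" "0 \<le> q'"
proof -
  have *: "0 < p' \<and> 0 < q \<and> q \<le> p \<and> 0 \<le> q'"
    if "cf_matrix as = (p, p', q, q')" "\<forall>a\<in>set as. a > 0" "as \<noteq> []" for as p p' q q'
    using that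
  proof (induction as arbitrary: p p' q q')
    case (Cons a as)
    obtain r r' s s' where M: "cf_matrix as = (r, r', s, s')" by (metis prod_cases4)
    have a: "a \<ge> 1" using Cons.prems by auto
    have e: "p = a * r + s" "p' = a * r' + s'" "q = r" "q' = r'" using Cons.prems M by auto
    show ?case
    proof (cases "as = []")
      case True
      then show ?thesis using e M a by auto
    next
      case False
      then have IH: "0 < r'" "0 < s" "s \<le> r" "0 \<le> s'"
        using Cons.IH[OF M] Cons.prems by auto
      have "1 * r \<le> a * r" "1 * r' \<le> a * r'" using a IH by (intro mult_right_mono; simp)+
      then show ?thesis unfolding e using IH by linarith
    qed
  qed simp
  \<comment> \<open>The bound \<open>p' \<le> p\<close> is the bound \<open>q \<le> p\<close> for
    the reversed digits, whose matrix is the transpose.\<close>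
  have "cf_matrix (rev as) = (p, q, p', q')" using assms(1) by (simp add: cf_matrix_rev)
  then have "p' \<le> p" using *[of "rev as"] assms by auto
  then show "0 < p'" "p' \<le> p" "0 < q" "q \<le> p" "0 \<le> q'" using *[OF assms] by auto
qed

text \<open>The weaker bounds also hold for the empty block, whose matrix is the identity; this
  block occurs for period length 1. The last bound holds for a nonempty block because
  \<open>q\<close> and \<open>p'\<close> both lie between 1 and \<open>p\<close>.\<close>

lemma cf_matrix_pos:
  assumes "cf_matrix as = (p, p', q, q')" "\<forall>a\<in>set as. a > 0"
  shows "0 < p" "0 \<le> p'" "0 \<le> q" "0 \<le> q'" "\<bar>q - p'\<bar> < p"
  using assms cf_matrix_bounds[OF assms] by (cases "as = []"; force)+

text \<open>The first column is \<open>(a * r + s, r)\<close> with \<open>0 \<le> s \<le> r\<close>,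
  so \<open>a\<close> is the quotient of its entries up to the borderline case \<open>s = r\<close>,
  which is settled by comparing the two remainders \<open>s\<close> and \<open>v\<close>.\<close>

lemma cf_matrix_leading_digit_le:
  assumes M: "cf_matrix (a # as) = cf_matrix (b # bs)" and len: "length as = length bs"
    and pos: "\<forall>a\<in>set as. a > 0" "\<forall>b\<in>set bs. b > 0"
  shows "b \<le> a"
proof (rule ccontr)
  assume "\<not> b \<le> a"
  then have ba: "b - a \<ge> 1" by simp
  obtain r r' s s' where A: "cf_matrix as = (r, r', s, s')" by (metis prod_cases4)
  obtain u u' v v' where B: "cf_matrix bs = (u, u', v, v')" by (metis prod_cases4)
  have ur: "u = r" and "a * r + s = b * r + v" using M A B by auto
  then have s: "s = (b - a) * r + v" by (simp add: algebra_simps)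
  have "1 * r \<le> (b - a) * r"
    using ba cf_matrix_pos[OF A pos(1)] by (intro mult_right_mono) auto
  then have "r + v \<le> s" using s by simp
  \<comment> \<open>Nonempty tails have \<open>s \<le> r\<close> and \<open>v > 0\<close>; empty
    tails have \<open>r = 1\<close> and \<open>s = v = 0\<close>. Equal lengths exclude a mixture of
    the two.\<close>
  then show False
    using cf_matrix_bounds(4)[OF A pos(1)] cf_matrix_bounds(3)[OF B pos(2)] A B len
    by (cases "as = []"; cases "bs = []") auto
qed

text \<open>The previous inequality, used in both directions, makes the leading digits equal; their
  common matrix then cancels.\<close>

lemma cf_matrix_inj:
  assumes "cf_matrix as = cf_matrix bs" "length as = length bs"
    "\<forall>a\<in>set as. a > 0" "\<forall>b\<in>set bs. b > 0"
  shows "as = bs"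
  using assms
proof (induction as arbitrary: bs)
  case (Cons a as)
  then obtain b bs' where bs: "bs = b # bs'" by (cases bs) auto
  have ab: "a = b"
    using cf_matrix_leading_digit_le[of a as b bs'] cf_matrix_leading_digit_le[of b bs' a as]
      Cons.prems bs by force
  have "cf_matrix as = cf_matrix bs'"
    using Cons.prems(1) unfolding bs ab by (auto split: prod.splits)
  then show ?case using Cons bs ab by auto
qed simp

lemma cf_matrix_symmetric_iff:
  assumes "cf_matrix as = (p, p', q, q')" "\<forall>a\<in>set as. a > 0"
  shows "q = p' \<longleftrightarrow> rev as = as"
proof -
  have rev: "cf_matrix (rev as) = (p, q, p', q')" using assms(1) by (simp add: cf_matrix_rev)
  have "cf_matrix (rev as) = cf_matrix as \<longleftrightarrow> rev as = as"
    using cf_matrix_inj[of "rev as" as] assms(2) by auto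
  then show ?thesis unfolding rev assms(1) by auto
qed

text \<open>The matrix acts as a Moebius transformation on the complete quotient \<open>z\<close>
  left after \<open>m\<close> digits; the denominator is cleared.\<close>

lemma cf_value_moebius:
  assumes "\<And>k. d k > 0" "cf_matrix (map d [0..<m]) = (p, p', q, q')"
  defines "z \<equiv> cf_value (\<lambda>k. d (k + m))"
  shows "cf_value d * (of_int q * z + of_int q') = of_int p * z + of_int p'"
  using assms(1,2) unfolding z_def
proof (induction m arbitrary: d p p' q q')
  case (Suc m)
  let ?s = "\<lambda>k. d (Suc k)"
  obtain r r' s s' where M: "cf_matrix (map ?s [0..<m]) = (r, r', s, s')" by (metis prod_cases4)
  have "map d [0..<Suc m] = d 0 # map ?s [0..<m]"
    by (rule map_upt_Suc)
  then have e: "p = d 0 * r + s" "p' = d 0 * r' + s'" "q = r" "q' = r'" using Suc.prems M by auto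
  have IH: "cf_value ?s * (of_int s * cf_value (\<lambda>k. d (k + Suc m)) + of_int s')
      = of_int r * cf_value (\<lambda>k. d (k + Suc m)) + of_int r'"
    using Suc.IH[OF Suc.prems(1) M] by simp
  have "cf_value ?s \<ge> 1" using Suc.prems(1) by (intro cf_value_ge_1)
  then show ?case
    unfolding e cf_value_Suc[of d, OF Suc.prems(1)] using IH by (simp add: field_simps)
qed simp

section \<open>The quadratic equation of a periodic continued fraction\<close>

text \<open>For a root \<open>m / n\<close> in lowest terms, the square of \<open>n\<close> divides
  the square of \<open>m\<close> and is coprime to it, hence is 1.\<close>

lemma int_square_if_rat_square:
  fixes N :: int and r :: real
  assumes "r \<in> \<rat>" "of_int N = r\<^sup>2"
  obtains k :: int where "N = k\<^sup>2" "k \<ge> 0"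
proof -
  obtain m n :: nat where mn: "n \<noteq> 0" "\<bar>r\<bar> = real m / real n" "coprime m n"
    using Rats_abs_nat_div_natE[OF assms(1)] by blast
  have "of_int N = (real m / real n)\<^sup>2" using assms(2) mn(2) by (metis power2_abs)
  then have "of_int N * (real n)\<^sup>2 = (real m)\<^sup>2" using mn(1) by (simp add: field_simps)
  then have eq: "N * (int n)\<^sup>2 = (int m)\<^sup>2"
    by (metis (mono_tags, lifting) of_int_eq_iff of_int_mult of_int_of_nat_eq of_int_power)
  then have "(int n)\<^sup>2 dvd (int m)\<^sup>2" by (metis dvd_triv_right)
  moreover have "coprime ((int m)\<^sup>2) ((int n)\<^sup>2)" using mn(3) by simp
  ultimately have "(int n)\<^sup>2 = 1"
    by (simp add: coprime_absorb_right power2_eq_1_iff)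
  then show thesis using eq that[of "int m"] by simp
qed

text \<open>If \<open>s > 0\<close>, then \<open>t\<close> lies strictly between \<open>s\<close>
  and \<open>s + 2\<close>, and \<open>t = s + 1\<close> fails by parity.\<close>

lemma square_diff_4_imp:
  fixes s t :: int
  assumes "t\<^sup>2 = s\<^sup>2 + 4" "s \<ge> 0" "t \<ge> 0"
  shows "s = 0 \<and> t = 2"
proof -
  have "s < t"
    using assms by (intro power_less_imp_less_base[of s 2 t]) auto
  moreover have "t < s + 2 \<or> s = 0"
  proof (rule disjCI)
    assume "s \<noteq> 0"
    then have "t\<^sup>2 < (s + 2)\<^sup>2" using assms by (simp add: power2_sum)
    then show "t < s + 2" using assms by (intro power_less_imp_less_base[of t 2 "s + 2"]) auto
  qed
  ultimately consider "t = s + 1" | "s = 0" by linarith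
  then show ?thesis
  proof cases
    case 1
    then have "2 * s = 3" using assms(1) by (simp add: power2_sum)
    then show ?thesis by presburger
  next
    case 2
    then have "t\<^sup>2 = 2\<^sup>2" using assms(1) by simp
    then show ?thesis using 2 assms(3) by (simp only: power2_eq_iff) auto
  qed
qed

text \<open>Completing the square. The constant term is \<open>- C\<close>, so the discriminant is
  \<open>B\<^sup>2 + 4 * A * C\<close>.\<close>

lemma quad_decomp_of_quadratic:
  fixes A B C :: int
  assumes eq: "of_int A * x\<^sup>2 + of_int B * x - of_int C = (0 :: real)" and "A \<noteq> 0"
    and "\<not> (\<exists>r\<in>\<rat>. of_int (B\<^sup>2 + 4 * A * C) = (r :: real)\<^sup>2)"
  shows "quad_decomp x (- of_int B / (2 * of_int A))
           (of_int (B\<^sup>2 + 4 * A * C) / (2 * of_int A)\<^sup>2)"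
proof -
  let ?a = "- of_int B / (2 * of_int A) :: real"
  let ?D = "of_int (B\<^sup>2 + 4 * A * C) :: real"
  let ?b = "?D / (2 * of_int A)\<^sup>2"
  have A: "of_int A \<noteq> (0 :: real)" using assms by simp
  have "(2 * of_int A * x + of_int B)\<^sup>2
      = 4 * of_int A * (of_int A * x\<^sup>2 + of_int B * x - of_int C) + ?D"
    by (simp add: power2_eq_square algebra_simps)
  then have sq: "(2 * of_int A * x + of_int B)\<^sup>2 = ?D" using eq by simp
  have "x - ?a = (2 * of_int A * x + of_int B) / (2 * of_int A)" using A by (simp add: field_simps)
  then have xa: "(x - ?a)\<^sup>2 = ?b" using sq by (simp add: power_divide)
  have nsq: "\<not> (\<exists>r\<in>\<rat>. ?b = r\<^sup>2)"
  proof
    assume "\<exists>r\<in>\<rat>. ?b = r\<^sup>2"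
    then obtain r where r: "r \<in> \<rat>" "?b = r\<^sup>2" by blast
    then have "?D = (r * (2 * of_int A))\<^sup>2" using A by (simp add: field_simps)
    moreover have "r * (2 * of_int A) \<in> \<rat>" using r by simp
    ultimately show False using assms(3) by blast
  qed
  \<comment> \<open>Zero is a rational square, so it is excluded together with the other
    squares.\<close>
  have "?b \<noteq> 0" using nsq by (metis Rats_0 zero_power2)
  moreover have "?b \<ge> 0" unfolding xa[symmetric] by simp
  ultimately have "?b > 0" by linarith
  \<comment> \<open>The root of \<open>(x - ?a)\<^sup>2\<close> is the absolute value of
    \<open>x - ?a\<close>, which accounts for both signs.\<close>
  moreover have "x = ?a + sqrt ?b \<or> x = ?a - sqrt ?b"
    unfolding xa[symmetric] real_sqrt_abs by linarith
  ultimately show ?thesis unfolding quad_decomp_def using nsq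
    by (intro conjI) (auto simp del: of_int_add of_int_mult of_int_power)
qed

lemma rational_part_periodic:
  fixes c :: "nat \<Rightarrow> int"
  assumes n: "n \<ge> 1" and c: "\<And>k. k \<in> {1..n} \<Longrightarrow> c k > 0"
    and M: "cf_matrix (map c [1..<n]) = (p, p', q, q')"
  shows "2 * rational_part (cf_value (periodic_digits n c)) =
           - of_int (c n) + of_int (q - p') / of_int p"
proof -
  \<comment> \<open>The purely periodic sequence obtained by dropping the initial 0; its digit 0 is
    \<open>c 1\<close>, and \<open>x\<close> is the reciprocal of its value.\<close>
  define d where "d k = c (k mod n + 1)" for k
  define x where "x = cf_value (periodic_digits n c)"
  have d: "d k > 0" for k unfolding d_def using n by (intro c) (auto simp: Suc_le_eq)
  have pos: "\<forall>a\<in>set (map c [1..<n]). a > 0" using c by auto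
  note b = cf_matrix_pos[OF M pos]
  have y1: "cf_value d \<ge> 1" using d by (rule cf_value_ge_1)
  have x: "x = 1 / cf_value d"
  proof -
    have shift: "(\<lambda>k. periodic_digits n c (Suc k)) = d"
      by (auto simp: periodic_digits_def d_def)
    then have pd: "periodic_digits n c (Suc k) > 0" for k using d by metis
    then show ?thesis
      unfolding x_def cf_value_Suc[of "periodic_digits n c", OF pd] shift
      by (simp add: periodic_digits_def)
  qed
  have full: "map d [0..<n] = map c [1..<n] @ [c n]"
  proof -
    have "map d [0..<n] = map (\<lambda>k. c (Suc k)) [0..<n]" by (auto simp: d_def)
    also have "\<dots> = map c [1..<Suc n]"
      by (simp add: map_Suc_upt[symmetric] comp_def del: upt_Suc)
    finally show ?thesis using n by simp
  qed
  \<comment> \<open>The first column of the matrix of the full period; the second column is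
    \<open>(p, q)\<close>.\<close>
  let ?A = "c n * p + p'" and ?C = "c n * q + q'"
  have MF: "cf_matrix (map d [0..<n]) = (?A, p, ?C, q)"
    unfolding full cf_matrix_snoc using M by simp
  \<comment> \<open>Shifting by a period fixes \<open>d\<close>, so the Moebius relation becomes a
    fixed-point equation. Division by the square of \<open>cf_value d\<close> turns it into a
    quadratic equation for the reciprocal \<open>x\<close>.\<close>
  have per: "(\<lambda>k. d (k + n)) = d" by (auto simp: d_def)
  have "cf_value d * (of_int ?C * cf_value d + of_int q) = of_int ?A * cf_value d + of_int p"
    using cf_value_moebius[OF d MF] unfolding per .
  then have quad: "of_int p * x\<^sup>2 + of_int (?A - q) * x - of_int ?C = 0"
    unfolding x using y1 by (simp add: field_simps power2_eq_square)
  have cn: "c n \<ge> 1" using c[of n] n by simp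
  have cp: "1 * p \<le> c n * p" using b cn by (intro mult_right_mono) auto
  have det: "?A * q - p * ?C = (-1) ^ n" using cf_matrix_det[OF MF] by simp
  \<comment> \<open>The trace of the period matrix: the discriminant is its square minus four times
    the determinant.\<close>
  let ?t = "?A + q"
  have disc: "(?A - q)\<^sup>2 + 4 * p * ?C = ?t\<^sup>2 - 4 * (-1) ^ n"
    unfolding det[symmetric] by (simp add: power2_eq_square algebra_simps)
  have irr: "\<not> (\<exists>r\<in>\<rat>. of_int ((?A - q)\<^sup>2 + 4 * p * ?C) = (r :: real)\<^sup>2)"
  proof
    assume "\<exists>r\<in>\<rat>. of_int ((?A - q)\<^sup>2 + 4 * p * ?C) = (r :: real)\<^sup>2"
    then obtain k where k: "(?A - q)\<^sup>2 + 4 * p * ?C = k\<^sup>2" "k \<ge> 0"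
      using int_square_if_rat_square by metis
    show False
    proof (cases "even n")
      case True
      \<comment> \<open>An even \<open>n\<close> is at least 2, so \<open>c n * p\<close>,
        \<open>p'\<close> and \<open>q\<close> are all at least 1. The trace is then at least 3,
        whereas a square discriminant would force it to be 2.\<close>
      then have "map c [1..<n] \<noteq> []" using n by (cases "n = 1") auto
      then have "?t \<ge> 3" using cf_matrix_bounds[OF M pos] cp by linarith
      moreover have "?t\<^sup>2 = k\<^sup>2 + 4" using k disc True by simp
      ultimately show False using square_diff_4_imp[of ?t k] k by simp
    next
      case False
      \<comment> \<open>Here a square discriminant would force the trace to be 0.\<close>
      have "?t > 0" using b cp by linarith
      moreover have "k\<^sup>2 = ?t\<^sup>2 + 4" using k disc False by simp
      ultimately show False using square_diff_4_imp[of k ?t] k by simp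
    qed
  qed
  have "rational_part x = - of_int (?A - q) / (2 * of_int p)"
    using b by (intro rational_part_eq[OF quad_decomp_of_quadratic[OF quad _ irr]]) auto
  then show ?thesis using b unfolding x_def by (simp add: field_simps)
qed

lemma rev_map_upt_eq_iff:
  "rev (map c [1..<n]) = map c [1..<n] \<longleftrightarrow> (\<forall>k\<in>{1..n-1}. c k = c (n - k))"
proof -
  have "rev (map c [1..<n]) = map c [1..<n] \<longleftrightarrow> (\<forall>i<n - 1. c (n - Suc i) = c (Suc i))"
    \<comment> \<open>The list has length \<open>n - 1\<close> and holds \<open>c (Suc i)\<close> at
      position \<open>i\<close>, so its reversal holds \<open>c (n - Suc i)\<close> there.\<close>
    by (auto simp: list_eq_iff_nth_eq rev_nth Suc_diff_Suc)
  also have "\<dots> \<longleftrightarrow> (\<forall>k\<in>Suc ` {..<n - 1}. c k = c (n - k))" by (auto; metis)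
  also have "Suc ` {..<n - 1} = {1..n - 1}"
    by (simp add: image_Suc_lessThan)
  finally show ?thesis .
qed

theorem theorem2:
  fixes n :: nat and c :: "nat \<Rightarrow> int" and x :: real
  assumes "n \<ge> 1"
    and "\<And>k. k \<in> {1..n} \<Longrightarrow> c k > 0"
    and "x = cf_value (periodic_digits n c)"
  shows "(2 * rational_part x \<in> \<int> \<longleftrightarrow> 2 * rational_part x = - of_int (c n)) \<and>
         (2 * rational_part x = - of_int (c n) \<longleftrightarrow> (\<forall>k\<in>{1..n-1}. c k = c (n - k)))"
proof -
  obtain p p' q q' where M: "cf_matrix (map c [1..<n]) = (p, p', q, q')" by (metis prod_cases4)
  have pos: "\<forall>a\<in>set (map c [1..<n]). a > 0" using assms(2) by auto
  note b = cf_matrix_pos[OF M pos]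
  have x: "2 * rational_part x = - of_int (c n) + of_int (q - p') / of_int p"
    unfolding assms(3) using assms(1,2) M by (rule rational_part_periodic)
  have eq_iff: "2 * rational_part x = - of_int (c n) \<longleftrightarrow> q = p'"
    unfolding x using b by auto
  have "q = p'" if "2 * rational_part x \<in> \<int>"
  proof -
    have "2 * rational_part x + of_int (c n) \<in> \<int>" using that by simp
    then obtain k where "of_int (q - p') / of_int p = (of_int k :: real)"
      unfolding x by (auto elim: Ints_cases)
    then have "(of_int (q - p') :: real) = of_int (k * p)" using b by (simp add: field_simps)
    then have "q - p' = k * p" by (simp only: of_int_eq_iff)
    \<comment> \<open>A multiple of \<open>p\<close> smaller than \<open>p\<close> in absolute value
      is 0.\<close>
    then have "p dvd q - p'" by simp
    then show "q = p'" using b(5) by (metis dvd_imp_le_int eq_iff_diff_eq_0 b(1) abs_of_pos not_le)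
  qed
  moreover have "2 * rational_part x \<in> \<int>" if "2 * rational_part x = - of_int (c n)"
    using that by simp
  ultimately show ?thesis
    using eq_iff cf_matrix_symmetric_iff[OF M pos] rev_map_upt_eq_iff[of c n] by blast
qed

end
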